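(* Let $N\subseteq\mathsf{Act}$ be a set of non-blocking actions. For every LTS $\mathcal{L}\in\mathcal{M}(N)$, every two states $p,q$ of $\mathcal{L}$, every LTS of tests $\mathcal{T}\in\mathcal{A}(N)$, and every label abstraction $\mathbb{A}$ that abstracts $(\mathcal{L},\mathcal{T})$: (1) if $p\sqsubseteq_{\mathbb{A}} q$ then $p\sqsubseteq_{\mathcal{T}} q$; (2) if $(\mathcal{T},\mathbb{A})\models\mathsf{AxCmpl}$ and $\mathbb{A}$ is finitary, then $p\sqsubseteq_{\mathcal{T}} q$ implies $p\sqsubseteq_{\mathbb{A}} q$.
   Context: Fix a countable set $\mathsf{Act}$ of visible actions, an invisible action $\tau\notin\mathsf{Act}$, $\mathsf{L}=\mathsf{Act}\cup\{\tau\}$, and an involutive duality $\mu\mapsto\overline{\mu}$ on $\mathsf{Act}$. $N\subseteq\mathsf{Act}$ (possibly empty) is the set of non-blocking actions, $B=\mathsf{Act}\setminus N$ the blocking ones. An LTS is $(S,\to,\mathsf{L})$ with $\to\subseteq S\times\mathsf{L}\times S$; write $p\xrightarrow{\alpha}q$, and $p\xrightarrow{\alpha}$ if some such $q$ exists. LTSs are finite-image. Axioms (quantified over all states, all $\alpha\in\mathsf{L}$, $\eta\in N$, $\mu\in\mathsf{Act}$ with $\mu\neq\eta$): N-delay: $p_1\xrightarrow{\eta}p_2\xrightarrow{\alpha}p_3$ implies $\exists p_4$, $p_1\xrightarrow{\alpha}p_4\xrightarrow{\eta}p_3$. N-confluence: $p_1\xrightarrow{\eta}p_2$ and $p_1\xrightarrow{\mu}p_3$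 imply $\exists p_4$, $p_2\xrightarrow{\mu}p_4$ and $p_3\xrightarrow{\eta}p_4$. N-determinacy: $p_1\xrightarrow{\eta}p_2$, $p_1\xrightarrow{\eta}p_3$ imply $p_2=p_3$. Backwards-N-determinacy: $p_2\xrightarrow{\eta}p_1$, $p_3\xrightarrow{\eta}p_1$ imply $p_2=p_3$. Fwd-Feedback: $p_1\xrightarrow{\eta}p_2\xrightarrow{\overline{\eta}}p_3$ implies $p_1\xrightarrow{\tau}p_3$ or $p_1=p_3$. Boomerang: for every $p$ there is $p'$ with $p\xrightarrow{\overline{\eta}}p'\xrightarrow{\eta}p$. N-tau: $p_1\xrightarrow{\eta}p_2$ and $p_1\xrightarrow{\tau}p_3$ imply either $\exists p_4$ with $p_2\xrightarrow{\tau}p_4$ and $p_3\xrightarrow{\eta}p_4$, or $p_2\xrightarrow{\overline{\eta}}p_3$. Feedback: $p\xrightarrow{\eta}q\xrightarrow{\overline{\eta}}q'$ implies $p\xrightarrow{\tau}q'$. $\mathcal{M}(N)$ is the class of LTSs satisfying N-delay, N-confluence, N-determinacy, backwards-N-determinacy, Fwd-Feedback, Boomerang, N-tau; $\mathcal{A}(N)$ the class satisfying N-delay, N-confluence, N-determinacy, backwards-N-determinacy, N-tau and Feedback. Testing: for program LTS $\mathcal{L}$ (states $P$) and test LTS $\mathcal{T}$ (states $T$), the composition has states $P\times T$ and steps $(p,t)\to(p',t)$ if $p\xrightarrow{\tau}p'$; $(p,t)\to(p,t')$ if $t\xrightarrow{\tau}t'$; $(p,t)\to(p',t')$ if $p\xrightarrow{\overline{\mu}}p'$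 and $t\xrightarrow{\mu}t'$ for some $\mu\in\mathsf{Act}$. A decidable predicate good on tests is fixed, with good$(t)\iff$good$(t')$ whenever $t\xrightarrow{\eta}t'$, $\eta\in N$. Must$(p,t)$ holds iff every maximal (infinite or non-extendable) computation from $(p,t)$ contains a state $(p_i,t_i)$ with good$(t_i)$. $p\sqsubseteq_{\mathcal{T}}q$ iff for all tests $t$ of $\mathcal{T}$, Must$(p,t)$ implies Must$(q,t)$. Alternative preorder: $R(p)=\{\mu\in\mathsf{Act}:p\xrightarrow{\mu}\}$, $\mathrm{coR}(p)=\{\beta\in B:p\xrightarrow{\overline{\beta}}\}$. A label abstraction is $\mathbb{A}=(\phi:B\to Y,\delta:Y\to X)$. It abstracts $(\mathcal{L},\mathcal{T})$ if for all $\beta,\beta'\in B$: (i) for every test $t$, $\phi(\beta)=\phi(\beta')$ and $\beta\in R(t)$ imply $\beta'\in R(t)$; (ii) for every $p\in P$, $\delta(\phi(\beta))=\delta(\phi(\beta'))$ and $\phi(\beta)\in\phi(\mathrm{coR}(p))$ imply $\phi(\beta')\in\phi(\mathrm{coR}(p))$. Let $\mathrm{coR}_{\mathbb{A}}(p)=\{\delta(\phi(\beta)):\beta\in\mathrm{coR}(p)\}$; $\mathbb{A}$ is finitary if all $\mathrm{coR}_{\mathbb{A}}(p)$ are finite. Weak transitions $p\overset{s}{\Rightarrow}q$ ($s\in\mathsf{Act}^*$) allow $\tau$-steps interleaved. $p$ converges along $s$, $p\Downarrow s$, if no state reachable by $p\overset{s'}{\Rightarrow}$ for a prefix $s'$ of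 $s$ has an infinite $\tau$-sequence. Waiting states: $\mathrm{ws}(p,s)=\{q:p\overset{s}{\Rightarrow}q,\ q\not\xrightarrow{\tau}\}$. Interpretation (defined iff $p\Downarrow s$): $[\![p]\!](s)=\{\mathrm{coR}_{\mathbb{A}}(q):q\in\mathrm{ws}(p,s)\}$. For families $\mathcal{A},\mathcal{B}$ of sets, $\mathcal{A}\ll\mathcal{B}$ iff every $x\in\mathcal{B}$ has some $y\in\mathcal{A}$ with $y\subseteq x$. $p\sqsubseteq_{\mathbb{A}}q$ iff for every $s\in\mathsf{Act}^*$, $p\Downarrow s$ implies $q\Downarrow s$ and $[\![p]\!](s)\ll[\![q]\!](s)$. $(\mathcal{T},\mathbb{A})\models\mathsf{AxCmpl}$ means there are $t_{cnv}:\mathsf{Act}^*\to T$ and $t_{acc}:\mathsf{Act}^*\times\mathcal{P}_{fin}(X)\to T$ such that for all $s$, $\mu,\mu'\in\mathsf{Act}$, finite $E\subseteq X$, and $f\in\{t_{cnv},t_{acc}(\cdot,E)\}$: (1) not good$(f(s))$; (2) $f(\mu.s)\xrightarrow{\mu}f(s)$; (3) $\mu\in B$ implies $f(\mu.s)\xrightarrow{\tau}$; (4) $\mu\in B$, $f(\mu.s)\xrightarrow{\tau}t$ imply good$(t)$; (5) $\mu\in B$, $f(\mu.s)\xrightarrow{\mu}t$ imply $t=f(s)$; (6) $\mu\in B$, $f(\mu.s)\xrightarrow{\mu'}t$, $\mu'\neq\mu$ imply good$(t)$; (a1) $t_{acc}(\varepsilon,E)\not\xrightarrow{\tau}$; (a2)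 $t_{acc}(\varepsilon,E)\not\xrightarrow{\eta}$ for $\eta\in N$; (a3) $t_{acc}(\varepsilon,E)\xrightarrow{\beta}$, $\beta\in B$ implies $\delta(\phi(\beta))\in E$; (a4) every $e\in E$ equals $\delta(\phi(\beta))$ for some $\beta\in B$ with $t_{acc}(\varepsilon,E)\xrightarrow{\beta}$; (a5) $\beta\in B$, $t_{acc}(\varepsilon,E)\xrightarrow{\beta}t$ imply good$(t)$; (c1) $t_{cnv}(\varepsilon)\not\xrightarrow{\mu}$ for all $\mu\in\mathsf{Act}$; (c2) $t_{cnv}(\varepsilon)\xrightarrow{\tau}$; (c3) $t_{cnv}(\varepsilon)\xrightarrow{\tau}t$ implies good$(t)$. *)

theory Defs
  imports "HOL-Library.Countable" "HOL-Library.FuncSet" "HOL-Library.Sublist"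
begin

text \<open>
  The visible actions are the elements of a type \<open>'a\<close>; \<open>Tau\<close> is the invisible action.  The duality
  \<open>co\<close> and the set \<open>N\<close> of non-blocking actions are parameters throughout, and \<open>- N\<close> is the set of
  blocking actions.
\<close>

datatype 'a label = Tau | Vis 'a

type_synonym ('s, 'a) lts = "'s \<Rightarrow> 'a label \<Rightarrow> 's \<Rightarrow> bool"

definition enabled :: "('s, 'a) lts \<Rightarrow> 's \<Rightarrow> 'a label \<Rightarrow> bool" where
  "enabled L p \<alpha> \<longleftrightarrow> (\<exists>q. L p \<alpha> q)"

definition finite_image :: "('s, 'a) lts \<Rightarrow> bool" where
  "finite_image L \<longleftrightarrow> (\<forall>p \<alpha>. finite {q. L p \<alpha> q})"

definition involutive :: "('a \<Rightarrow> 'a) \<Rightarrow> bool" where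
  "involutive co \<longleftrightarrow> (\<forall>\<mu>. co (co \<mu>) = \<mu>)"


subsection \<open>Axioms on LTSs\<close>

definition N_delay :: "'a set \<Rightarrow> ('s, 'a) lts \<Rightarrow> bool" where
  "N_delay N L \<longleftrightarrow> (\<forall>\<eta>\<in>N. \<forall>\<alpha> p1 p2 p3.
     L p1 (Vis \<eta>) p2 \<and> L p2 \<alpha> p3 \<longrightarrow> (\<exists>p4. L p1 \<alpha> p4 \<and> L p4 (Vis \<eta>) p3))"

definition N_confluence :: "'a set \<Rightarrow> ('s, 'a) lts \<Rightarrow> bool" where
  "N_confluence N L \<longleftrightarrow> (\<forall>\<eta>\<in>N. \<forall>\<mu> p1 p2 p3.
     \<mu> \<noteq> \<eta> \<and> L p1 (Vis \<eta>) p2 \<and> L p1 (Vis \<mu>) p3 \<longrightarrow> (\<exists>p4. L p2 (Vis \<mu>) p4 \<and> L p3 (Vis \<eta>) p4))"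

definition N_determinacy :: "'a set \<Rightarrow> ('s, 'a) lts \<Rightarrow> bool" where
  "N_determinacy N L \<longleftrightarrow> (\<forall>\<eta>\<in>N. \<forall>p1 p2 p3.
     L p1 (Vis \<eta>) p2 \<and> L p1 (Vis \<eta>) p3 \<longrightarrow> p2 = p3)"

definition backwards_N_determinacy :: "'a set \<Rightarrow> ('s, 'a) lts \<Rightarrow> bool" where
  "backwards_N_determinacy N L \<longleftrightarrow> (\<forall>\<eta>\<in>N. \<forall>p1 p2 p3.
     L p2 (Vis \<eta>) p1 \<and> L p3 (Vis \<eta>) p1 \<longrightarrow> p2 = p3)"

definition Fwd_Feedback :: "('a \<Rightarrow> 'a) \<Rightarrow> 'a set \<Rightarrow> ('s, 'a) lts \<Rightarrow> bool" where
  "Fwd_Feedback co N L \<longleftrightarrow> (\<forall>\<eta>\<in>N. \<forall>p1 p2 p3.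
     L p1 (Vis \<eta>) p2 \<and> L p2 (Vis (co \<eta>)) p3 \<longrightarrow> L p1 Tau p3 \<or> p1 = p3)"

definition Boomerang :: "('a \<Rightarrow> 'a) \<Rightarrow> 'a set \<Rightarrow> ('s, 'a) lts \<Rightarrow> bool" where
  "Boomerang co N L \<longleftrightarrow> (\<forall>\<eta>\<in>N. \<forall>p. \<exists>p'. L p (Vis (co \<eta>)) p' \<and> L p' (Vis \<eta>) p)"

definition N_tau :: "('a \<Rightarrow> 'a) \<Rightarrow> 'a set \<Rightarrow> ('s, 'a) lts \<Rightarrow> bool" where
  "N_tau co N L \<longleftrightarrow> (\<forall>\<eta>\<in>N. \<forall>p1 p2 p3.
     L p1 (Vis \<eta>) p2 \<and> L p1 Tau p3 \<longrightarrow>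
       (\<exists>p4. L p2 Tau p4 \<and> L p3 (Vis \<eta>) p4) \<or> L p2 (Vis (co \<eta>)) p3)"

definition Feedback :: "('a \<Rightarrow> 'a) \<Rightarrow> 'a set \<Rightarrow> ('s, 'a) lts \<Rightarrow> bool" where
  "Feedback co N L \<longleftrightarrow> (\<forall>\<eta>\<in>N. \<forall>p q q'.
     L p (Vis \<eta>) q \<and> L q (Vis (co \<eta>)) q' \<longrightarrow> L p Tau q')"

definition class_M :: "('a \<Rightarrow> 'a) \<Rightarrow> 'a set \<Rightarrow> ('s, 'a) lts \<Rightarrow> bool" where
  "class_M co N L \<longleftrightarrow>
     N_delay N L \<and> N_confluence N L \<and> N_determinacy N L \<and> backwards_N_determinacy N L \<and>
     Fwd_Feedback co N L \<and> Boomerang co N L \<and> N_tau co N L"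

definition class_A :: "('a \<Rightarrow> 'a) \<Rightarrow> 'a set \<Rightarrow> ('s, 'a) lts \<Rightarrow> bool" where
  "class_A co N L \<longleftrightarrow>
     N_delay N L \<and> N_confluence N L \<and> N_determinacy N L \<and> backwards_N_determinacy N L \<and>
     N_tau co N L \<and> Feedback co N L"


subsection \<open>Must testing\<close>

inductive comp_step ::
  "('a \<Rightarrow> 'a) \<Rightarrow> ('p, 'a) lts \<Rightarrow> ('t, 'a) lts \<Rightarrow> 'p \<times> 't \<Rightarrow> 'p \<times> 't \<Rightarrow> bool"
  for co :: "'a \<Rightarrow> 'a" and L :: "('p, 'a) lts" and T :: "('t, 'a) lts" where
  program_tau: "L p Tau p' \<Longrightarrow> comp_step co L T (p, t) (p', t)"
| test_tau: "T t Tau t' \<Longrightarrow> comp_step co L T (p, t) (p, t')"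
| communication:
    "L p (Vis (co \<mu>)) p' \<Longrightarrow> T t (Vis \<mu>) t' \<Longrightarrow> comp_step co L T (p, t) (p', t')"

definition infinite_computation :: "('s \<Rightarrow> 's \<Rightarrow> bool) \<Rightarrow> 's \<Rightarrow> (nat \<Rightarrow> 's) \<Rightarrow> bool" where
  "infinite_computation step x c \<longleftrightarrow> c 0 = x \<and> (\<forall>i. step (c i) (c (Suc i)))"

definition finite_maximal_computation :: "('s \<Rightarrow> 's \<Rightarrow> bool) \<Rightarrow> 's \<Rightarrow> 's list \<Rightarrow> bool" where
  "finite_maximal_computation step x cs \<longleftrightarrow>
     cs \<noteq> [] \<and> hd cs = x \<and> successively step cs \<and> \<not> (\<exists>y. step (last cs) y)"

definition good_invariant :: "'a set \<Rightarrow> ('t, 'a) lts \<Rightarrow> ('t \<Rightarrow> bool) \<Rightarrow> bool" where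
  "good_invariant N T good \<longleftrightarrow> (\<forall>\<eta>\<in>N. \<forall>t t'. T t (Vis \<eta>) t' \<longrightarrow> (good t \<longleftrightarrow> good t'))"

definition must ::
  "('a \<Rightarrow> 'a) \<Rightarrow> ('p, 'a) lts \<Rightarrow> ('t, 'a) lts \<Rightarrow> ('t \<Rightarrow> bool) \<Rightarrow> 'p \<Rightarrow> 't \<Rightarrow> bool" where
  "must co L T good p t \<longleftrightarrow>
     (\<forall>c. infinite_computation (comp_step co L T) (p, t) c \<longrightarrow> (\<exists>i. good (snd (c i)))) \<and>
     (\<forall>cs. finite_maximal_computation (comp_step co L T) (p, t) cs \<longrightarrow> (\<exists>x\<in>set cs. good (snd x)))"

definition must_preorder ::
  "('a \<Rightarrow> 'a) \<Rightarrow> ('p, 'a) lts \<Rightarrow> ('t, 'a) lts \<Rightarrow> ('t \<Rightarrow> bool) \<Rightarrow> 'p \<Rightarrow> 'p \<Rightarrow> bool" where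
  "must_preorder co L T good p q \<longleftrightarrow> (\<forall>t. must co L T good p t \<longrightarrow> must co L T good q t)"


subsection \<open>The alternative preorder\<close>

definition R :: "('s, 'a) lts \<Rightarrow> 's \<Rightarrow> 'a set" where
  "R L p = {\<mu>. enabled L p (Vis \<mu>)}"

definition coR :: "('a \<Rightarrow> 'a) \<Rightarrow> 'a set \<Rightarrow> ('s, 'a) lts \<Rightarrow> 's \<Rightarrow> 'a set" where
  "coR co N L p = {\<beta> \<in> - N. enabled L p (Vis (co \<beta>))}"

text \<open>
  The sets \<open>Y\<close> and \<open>X\<close> are explicit carriers rather than types, so that they may be empty when all
  actions are non-blocking.  The function \<open>phi\<close> only matters on blocking actions, \<open>delta\<close> only on \<open>Y\<close>.
\<close>

record ('a, 'y, 'x) label_abs =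
  absY :: "'y set"
  absX :: "'x set"
  phi :: "'a \<Rightarrow> 'y"
  delta :: "'y \<Rightarrow> 'x"

definition label_abstraction :: "'a set \<Rightarrow> ('a, 'y, 'x) label_abs \<Rightarrow> bool" where
  "label_abstraction N A \<longleftrightarrow> phi A \<in> - N \<rightarrow> absY A \<and> delta A \<in> absY A \<rightarrow> absX A"

definition abstracts ::
  "('a \<Rightarrow> 'a) \<Rightarrow> 'a set \<Rightarrow> ('a, 'y, 'x) label_abs \<Rightarrow> ('p, 'a) lts \<Rightarrow> ('t, 'a) lts \<Rightarrow> bool" where
  "abstracts co N A L T \<longleftrightarrow> (\<forall>\<beta>\<in>- N. \<forall>\<beta>'\<in>- N.
     (\<forall>t. phi A \<beta> = phi A \<beta>' \<and> \<beta> \<in> R T t \<longrightarrow> \<beta>' \<in> R T t) \<and>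
     (\<forall>p. delta A (phi A \<beta>) = delta A (phi A \<beta>') \<and> phi A \<beta> \<in> phi A ` coR co N L p \<longrightarrow>
          phi A \<beta>' \<in> phi A ` coR co N L p))"

definition coR_abs ::
  "('a \<Rightarrow> 'a) \<Rightarrow> 'a set \<Rightarrow> ('a, 'y, 'x) label_abs \<Rightarrow> ('s, 'a) lts \<Rightarrow> 's \<Rightarrow> 'x set" where
  "coR_abs co N A L p = (\<lambda>\<beta>. delta A (phi A \<beta>)) ` coR co N L p"

definition finitary ::
  "('a \<Rightarrow> 'a) \<Rightarrow> 'a set \<Rightarrow> ('a, 'y, 'x) label_abs \<Rightarrow> ('s, 'a) lts \<Rightarrow> bool" where
  "finitary co N A L \<longleftrightarrow> (\<forall>p. finite (coR_abs co N A L p))"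

inductive weak :: "('s, 'a) lts \<Rightarrow> 's \<Rightarrow> 'a list \<Rightarrow> 's \<Rightarrow> bool"
  for L :: "('s, 'a) lts" where
  weak_refl: "weak L p [] p"
| weak_tau: "L p Tau q \<Longrightarrow> weak L q s r \<Longrightarrow> weak L p s r"
| weak_vis: "L p (Vis \<mu>) q \<Longrightarrow> weak L q s r \<Longrightarrow> weak L p (\<mu> # s) r"

definition diverges :: "('s, 'a) lts \<Rightarrow> 's \<Rightarrow> bool" where
  "diverges L p \<longleftrightarrow> (\<exists>c. infinite_computation (\<lambda>x y. L x Tau y) p c)"

definition converges_along :: "('s, 'a) lts \<Rightarrow> 's \<Rightarrow> 'a list \<Rightarrow> bool" where
  "converges_along L p s \<longleftrightarrow> (\<forall>s' q. prefix s' s \<and> weak L p s' q \<longrightarrow> \<not> diverges L q)"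

definition waiting_states :: "('s, 'a) lts \<Rightarrow> 's \<Rightarrow> 'a list \<Rightarrow> 's set" where
  "waiting_states L p s = {q. weak L p s q \<and> \<not> enabled L q Tau}"

text \<open>The interpretation is only meaningful, and only used below, when \<open>p\<close> converges along \<open>s\<close>.\<close>

definition interp ::
  "('a \<Rightarrow> 'a) \<Rightarrow> 'a set \<Rightarrow> ('a, 'y, 'x) label_abs \<Rightarrow> ('s, 'a) lts \<Rightarrow> 's \<Rightarrow> 'a list \<Rightarrow> 'x set set" where
  "interp co N A L p s = coR_abs co N A L ` waiting_states L p s"

definition family_le :: "'x set set \<Rightarrow> 'x set set \<Rightarrow> bool" where
  "family_le F G \<longleftrightarrow> (\<forall>x\<in>G. \<exists>y\<in>F. y \<subseteq> x)"

definition abs_preorder ::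
  "('a \<Rightarrow> 'a) \<Rightarrow> 'a set \<Rightarrow> ('a, 'y, 'x) label_abs \<Rightarrow> ('s, 'a) lts \<Rightarrow> 's \<Rightarrow> 's \<Rightarrow> bool" where
  "abs_preorder co N A L p q \<longleftrightarrow> (\<forall>s. converges_along L p s \<longrightarrow>
     converges_along L q s \<and> family_le (interp co N A L p s) (interp co N A L q s))"


subsection \<open>Axioms for completeness\<close>

definition test_family :: "'a set \<Rightarrow> ('t, 'a) lts \<Rightarrow> ('t \<Rightarrow> bool) \<Rightarrow> ('a list \<Rightarrow> 't) \<Rightarrow> bool" where
  "test_family N T good f \<longleftrightarrow> (\<forall>s \<mu> \<mu>'.
     \<not> good (f s) \<and>
     T (f (\<mu> # s)) (Vis \<mu>) (f s) \<and>
     (\<mu> \<in> - N \<longrightarrow> enabled T (f (\<mu> # s)) Tau) \<and>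
     (\<forall>t. \<mu> \<in> - N \<and> T (f (\<mu> # s)) Tau t \<longrightarrow> good t) \<and>
     (\<forall>t. \<mu> \<in> - N \<and> T (f (\<mu> # s)) (Vis \<mu>) t \<longrightarrow> t = f s) \<and>
     (\<forall>t. \<mu> \<in> - N \<and> T (f (\<mu> # s)) (Vis \<mu>') t \<and> \<mu>' \<noteq> \<mu> \<longrightarrow> good t))"

definition acc_base ::
  "'a set \<Rightarrow> ('a, 'y, 'x) label_abs \<Rightarrow> ('t, 'a) lts \<Rightarrow> ('t \<Rightarrow> bool) \<Rightarrow> 'x set \<Rightarrow> 't \<Rightarrow> bool" where
  "acc_base N A T good E t0 \<longleftrightarrow>
     \<not> enabled T t0 Tau \<and>
     (\<forall>\<eta>\<in>N. \<not> enabled T t0 (Vis \<eta>)) \<and>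
     (\<forall>\<beta>\<in>- N. enabled T t0 (Vis \<beta>) \<longrightarrow> delta A (phi A \<beta>) \<in> E) \<and>
     (\<forall>e\<in>E. \<exists>\<beta>\<in>- N. e = delta A (phi A \<beta>) \<and> enabled T t0 (Vis \<beta>)) \<and>
     (\<forall>\<beta>\<in>- N. \<forall>t. T t0 (Vis \<beta>) t \<longrightarrow> good t)"

definition cnv_base :: "('t, 'a) lts \<Rightarrow> ('t \<Rightarrow> bool) \<Rightarrow> 't \<Rightarrow> bool" where
  "cnv_base T good t0 \<longleftrightarrow>
     (\<forall>\<mu>. \<not> enabled T t0 (Vis \<mu>)) \<and>
     enabled T t0 Tau \<and>
     (\<forall>t. T t0 Tau t \<longrightarrow> good t)"

definition AxCmpl ::
  "'a set \<Rightarrow> ('t, 'a) lts \<Rightarrow> ('t \<Rightarrow> bool) \<Rightarrow> ('a, 'y, 'x) label_abs \<Rightarrow> bool" where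
  "AxCmpl N T good A \<longleftrightarrow> (\<exists>t_cnv t_acc.
     test_family N T good t_cnv \<and> cnv_base T good (t_cnv []) \<and>
     (\<forall>E. finite E \<and> E \<subseteq> absX A \<longrightarrow>
        test_family N T good (\<lambda>s. t_acc s E) \<and> acc_base N A T good E (t_acc [] E)))"

end

theory Submission
  imports Defs "HOL-Library.Multiset"
begin

text \<open>
  Must-testing is an inductive predicate on the states of the composition, so both directions are
  inductions.

  Soundness is generalised from one program to a finite set \<open>X\<close> of programs, all of which must pass
  \<open>t\<close>.  When \<open>q\<close> communicates with \<open>t\<close>, the set \<open>X\<close> is replaced by the set of its weak derivatives,
  which is finite by convergence; the multiset order over the computation steps decreases.

  For completeness, a test \<open>t\<close> with \<open>t \<rightarrow>\<^sup>\<eta> t'\<close> in parallel with \<open>p\<close> is simulated by \<open>t'\<close> in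
  parallel with the program \<open>p'\<close> such that \<open>p' \<rightarrow>\<^sup>\<eta> p\<close>: the message \<open>\<eta>\<close> may be moved from the test
  to the program.  Boomerang provides \<open>p'\<close> as a \<open>co \<eta>\<close>-derivative of \<open>p\<close>, so a non-blocking prefix
  of a characteristic test can be consumed at once, as a blocking one is.
\<close>

section \<open>Inductive must-testing\<close>

text \<open>As a least fixed point it gives an induction over all computations at once. The premise
  \<open>step x y\<close> of \<open>later\<close> keeps a stuck state that is not good from passing
  vacuously.\<close>

inductive always_reaches :: "('s \<Rightarrow> 's \<Rightarrow> bool) \<Rightarrow> ('s \<Rightarrow> bool) \<Rightarrow> 's \<Rightarrow> bool"
  for step :: "'s \<Rightarrow> 's \<Rightarrow> bool" and G :: "'s \<Rightarrow> bool" where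
  now: "G x \<Longrightarrow> always_reaches step G x"
| later: "step x y \<Longrightarrow> (\<And>z. step x z \<Longrightarrow> always_reaches step G z) \<Longrightarrow> always_reaches step G x"

lemma always_reaches_step:
  "always_reaches step G x \<Longrightarrow> \<not> G x \<Longrightarrow> step x y \<Longrightarrow> always_reaches step G y"
  by (auto elim: always_reaches.cases)

lemma always_reaches_progress:
  "always_reaches step G x \<Longrightarrow> \<not> G x \<Longrightarrow> \<exists>y. step x y"
  by (auto elim: always_reaches.cases)

lemma always_reaches_infinite_computation:
  assumes "always_reaches step G x" "infinite_computation step x c"
  shows "\<exists>i. G (c i)"
  using assms
proof (induction arbitrary: c)
  case (now x)
  then show ?case by (auto simp: infinite_computation_def)
next
  case (later x y)
  have "step x (c 1)" "infinite_computation step (c 1) (\<lambda>i. c (Suc i))"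
    using later.prems by (auto simp: infinite_computation_def)
  from later.IH[OF this] show ?case by blast
qed

lemma always_reaches_finite_maximal_computation:
  assumes "always_reaches step G x" "finite_maximal_computation step x cs"
  shows "\<exists>y\<in>set cs. G y"
  using assms
proof (induction arbitrary: cs)
  case (now x)
  then show ?case by (auto simp: finite_maximal_computation_def intro!: bexI[of _ x])
next
  case (later x y)
  from later.prems obtain ds where cs: "cs = x # ds"
    by (cases cs) (auto simp: finite_maximal_computation_def)
  have "ds \<noteq> []" using later.prems later.hyps cs by (auto simp: finite_maximal_computation_def)
  then have "step x (hd ds)" "finite_maximal_computation step (hd ds) ds"
    using later.prems cs by (auto simp: finite_maximal_computation_def successively_Cons)
  from later.IH[OF this] show ?case by (auto simp: cs)
qed

text \<open>A failing state is not in \<open>G\<close> and is either stuck or has a failing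
  successor. If a stuck one can be reached through failing states, the path to it is a finite
  maximal computation; otherwise dependent choice yields an infinite one.\<close>

lemma not_always_reaches_computation:
  assumes "\<not> always_reaches step G x"
  shows "(\<exists>c. infinite_computation step x c \<and> (\<forall>i. \<not> G (c i))) \<or>
         (\<exists>cs. finite_maximal_computation step x cs \<and> (\<forall>y\<in>set cs. \<not> G y))"
proof -
  define bad where "bad = (\<lambda>y. \<not> always_reaches step G y)"
  have not_G: "\<not> G y" if "bad y" for y
    using that by (auto simp: bad_def intro: now)
  let ?r = "\<lambda>y z. bad y \<and> step y z \<and> bad z"
  show ?thesis
  proof (cases "\<exists>y. ?r\<^sup>*\<^sup>* x y \<and> bad y \<and> (\<nexists>z. step y z)")
    case True
    then obtain y where y: "?r\<^sup>*\<^sup>* x y" "bad y" "\<nexists>z. step y z" by blast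
    from y(1) have "\<exists>cs. finite_maximal_computation step x cs \<and> (\<forall>y\<in>set cs. \<not> G y)"
    proof (induction rule: converse_rtranclp_induct)
      case base
      have "finite_maximal_computation step y [y]"
        using y by (simp add: finite_maximal_computation_def)
      with not_G[OF y(2)] show ?case by (intro exI[of _ "[y]"]) auto
    next
      case (step u v)
      then obtain cs where "finite_maximal_computation step v cs" "\<forall>y\<in>set cs. \<not> G y" by blast
      then have "finite_maximal_computation step u (u # cs)" "\<forall>y\<in>set (u # cs). \<not> G y"
        using step.hyps not_G by (auto simp: finite_maximal_computation_def successively_Cons)
      then show ?case by blast
    qed
    then show ?thesis by blast
  next
    case False
    \<comment> \<open>The clause for \<open>i = 0\<close> pins the start of the chosen sequence to
      \<open>x\<close>.\<close>
    have "\<exists>c. \<forall>i. (?r\<^sup>*\<^sup>* x (c i) \<and> bad (c i) \<and> (i = 0 \<longrightarrow> c i = x)) \<and> step (c i) (c (Suc i))"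
    proof (rule dependent_nat_choice)
      show "\<exists>y. ?r\<^sup>*\<^sup>* x y \<and> bad y \<and> ((0::nat) = 0 \<longrightarrow> y = x)"
        using assms by (auto simp: bad_def)
      fix y and n :: nat
      assume y: "?r\<^sup>*\<^sup>* x y \<and> bad y \<and> (n = 0 \<longrightarrow> y = x)"
      with False obtain z where "step y z" by blast
      then obtain z where "step y z" "bad z"
        using y by (metis bad_def later)
      with y show "\<exists>z. (?r\<^sup>*\<^sup>* x z \<and> bad z \<and> (Suc n = 0 \<longrightarrow> z = x)) \<and> step y z"
        by (metis (no_types, lifting) nat.distinct(1) rtranclp.rtrancl_into_rtrancl)
    qed
    then show ?thesis using not_G by (auto simp: infinite_computation_def)
  qed
qed

abbreviation passes ::
  "('a \<Rightarrow> 'a) \<Rightarrow> ('p, 'a) lts \<Rightarrow> ('t, 'a) lts \<Rightarrow> ('t \<Rightarrow> bool) \<Rightarrow> 'p \<Rightarrow> 't \<Rightarrow> bool" where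
  "passes co L T good p t \<equiv> always_reaches (comp_step co L T) (\<lambda>x. good (snd x)) (p, t)"

lemma must_iff_passes: "must co L T good p t \<longleftrightarrow> passes co L T good p t"
proof
  assume "must co L T good p t"
  then show "passes co L T good p t"
    using not_always_reaches_computation[of "comp_step co L T" "\<lambda>x. good (snd x)" "(p, t)"]
    unfolding must_def by blast
next
  assume "passes co L T good p t"
  then show "must co L T good p t"
    using always_reaches_infinite_computation always_reaches_finite_maximal_computation
    unfolding must_def by fastforce
qed

lemma comp_stepE [consumes 1]:
  assumes "comp_step co L T (p, t) x"
  obtains (program_tau) p' where "x = (p', t)" "L p Tau p'"
  | (test_tau) t' where "x = (p, t')" "T t Tau t'"
  | (communication) \<mu> p' t' where "x = (p', t')" "L p (Vis (co \<mu>)) p'" "T t (Vis \<mu>) t'"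
  using assms by (cases rule: comp_step.cases) auto

section \<open>Weak transitions and convergence\<close>

text \<open>A counterexample has a counterexample among its \<tau>-successors, so dependent choice
  would build a divergence. This is the induction used below whenever a program moves on its
  own.\<close>

lemma not_diverges_induct [consumes 1, case_names step]:
  assumes "\<not> diverges L p"
    and step: "\<And>x. \<not> diverges L x \<Longrightarrow> (\<And>y. L x Tau y \<Longrightarrow> P y) \<Longrightarrow> P x"
  shows "P p"
proof (rule ccontr)
  assume "\<not> P p"
  have tau: "\<not> diverges L y" if "\<not> diverges L x" "L x Tau y" for x y
  proof
    assume "diverges L y"
    then obtain c where "infinite_computation (\<lambda>x y. L x Tau y) y c" by (auto simp: diverges_def)
    \<comment> \<open>\<open>case_nat x c\<close> is the sequence \<open>c\<close> with
      \<open>x\<close> put in front.\<close>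
    then have "infinite_computation (\<lambda>x y. L x Tau y) x (case_nat x c)"
      using that by (auto simp: infinite_computation_def split: nat.split)
    with that show False by (auto simp: diverges_def)
  qed
  have "\<exists>c. \<forall>i. (\<not> diverges L (c i) \<and> \<not> P (c i) \<and> (i = 0 \<longrightarrow> c i = p)) \<and> L (c i) Tau (c (Suc i))"
  proof (rule dependent_nat_choice)
    show "\<exists>x. \<not> diverges L x \<and> \<not> P x \<and> ((0::nat) = 0 \<longrightarrow> x = p)"
      using assms \<open>\<not> P p\<close> by blast
    fix x and n :: nat
    assume "\<not> diverges L x \<and> \<not> P x \<and> (n = 0 \<longrightarrow> x = p)"
    with step tau show "\<exists>y. (\<not> diverges L y \<and> \<not> P y \<and> (Suc n = 0 \<longrightarrow> y = p)) \<and> L x Tau y"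
      by blast
  qed
  then have "diverges L p" unfolding diverges_def infinite_computation_def by blast
  with assms show False by blast
qed

lemma weak_Nil_trans: "weak L p u x \<Longrightarrow> u = [] \<Longrightarrow> weak L x s r \<Longrightarrow> weak L p s r"
  by (induction rule: weak.induct) (auto intro: weak.intros)

lemma weak_Cons_cases:
  assumes "weak L p (\<mu> # s) r"
  obtains x y where "weak L p [] x" "L x (Vis \<mu>) y" "weak L y s r"
proof -
  have "weak L p u r \<Longrightarrow> u = \<mu> # s \<Longrightarrow> \<exists>x y. weak L p [] x \<and> L x (Vis \<mu>) y \<and> weak L y s r" for u
    by (induction rule: weak.induct) (auto intro: weak.intros)
  with assms that show thesis by blast
qed

lemma converges_along_not_diverges: "converges_along L p s \<Longrightarrow> \<not> diverges L p"
  by (metis converges_along_def Nil_prefix weak_refl)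

lemma converges_along_tau: "converges_along L p s \<Longrightarrow> L p Tau q \<Longrightarrow> converges_along L q s"
  unfolding converges_along_def using weak_tau[of L p q] by blast

lemma converges_along_weak_Nil:
  "converges_along L p s \<Longrightarrow> weak L p [] q \<Longrightarrow> converges_along L q s"
  unfolding converges_along_def using weak_Nil_trans[of L p "[]" q] by blast

lemma converges_along_vis:
  "converges_along L p (\<mu> # s) \<Longrightarrow> L p (Vis \<mu>) q \<Longrightarrow> converges_along L q s"
  unfolding converges_along_def using weak_vis[of L p \<mu> q] Cons_prefix_Cons[of \<mu> _ \<mu> s] by blast

lemma converges_along_NilI:
  assumes "\<not> diverges L p"
  shows "converges_along L p []"
proof -
  have "weak L p u q \<Longrightarrow> u = [] \<Longrightarrow> diverges L q \<Longrightarrow> diverges L p" for u q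
  proof (induction rule: weak.induct)
    case (weak_tau p q s r)
    then obtain c where "infinite_computation (\<lambda>x y. L x Tau y) q c" by (auto simp: diverges_def)
    then have "infinite_computation (\<lambda>x y. L x Tau y) p (case_nat p c)"
      using weak_tau.hyps(1) by (auto simp: infinite_computation_def split: nat.split)
    then show ?case by (auto simp: diverges_def)
  qed auto
  with assms show ?thesis by (auto simp: converges_along_def)
qed

lemma converges_along_ConsI:
  assumes "\<not> diverges L p"
    and "\<And>x y. weak L p [] x \<Longrightarrow> L x (Vis \<mu>) y \<Longrightarrow> converges_along L y s"
  shows "converges_along L p (\<mu> # s)"
  unfolding converges_along_def
proof (intro allI impI, elim conjE)
  fix s' q assume s': "prefix s' (\<mu> # s)" and q: "weak L p s' q"
  show "\<not> diverges L q"
  proof (cases s')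
    case Nil
    then show ?thesis using q converges_along_NilI[OF assms(1)] by (auto simp: converges_along_def)
  next
    case (Cons \<nu> s'')
    with s' have *: "\<nu> = \<mu>" "prefix s'' s" by auto
    from q Cons * obtain x y where "weak L p [] x" "L x (Vis \<mu>) y" "weak L y s'' q"
      by (metis weak_Cons_cases)
    with assms(2) * show ?thesis by (auto simp: converges_along_def)
  qed
qed

section \<open>Finiteness from convergence\<close>

text \<open>Koenig's lemma in inductive form: finitely many \<tau>-successors, each with finitely
  many weak derivatives by induction.\<close>

lemma finite_weak_Nil:
  assumes "finite_image L" "\<not> diverges L p"
  shows "finite {x. weak L p [] x}"
  using assms(2)
proof (induction rule: not_diverges_induct)
  case (step p)
  have "{x. weak L p [] x} \<subseteq> insert p (\<Union>y\<in>{y. L p Tau y}. {x. weak L y [] x})"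
    by (auto elim: weak.cases)
  moreover have "finite {y. L p Tau y}" using assms(1) by (auto simp: finite_image_def)
  ultimately show ?case using step.IH by (auto intro: finite_subset)
qed

lemma finite_weak_derivatives:
  assumes "finite_image L" "\<not> diverges L p"
  shows "finite {y. \<exists>x. weak L p [] x \<and> L x (Vis \<mu>) y}"
proof -
  have "{y. \<exists>x. weak L p [] x \<and> L x (Vis \<mu>) y} = (\<Union>x\<in>{x. weak L p [] x}. {y. L x (Vis \<mu>) y})"
    by auto
  moreover have "finite {y. L x (Vis \<mu>) y}" for x using assms(1) by (simp add: finite_image_def)
  ultimately show ?thesis using finite_weak_Nil[OF assms] by simp
qed

lemma finite_weak:
  assumes "finite_image L" "converges_along L p s"
  shows "finite {x. weak L p s x}"
  using assms(2)
proof (induction s arbitrary: p)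
  case Nil
  show ?case by (rule finite_weak_Nil[OF assms(1) converges_along_not_diverges[OF Nil]])
next
  case (Cons \<mu> s)
  let ?D = "{y. \<exists>x. weak L p [] x \<and> L x (Vis \<mu>) y}"
  have "{x. weak L p (\<mu> # s) x} \<subseteq> (\<Union>y\<in>?D. {x. weak L y s x})"
    by (blast elim: weak_Cons_cases)
  moreover have "finite ?D"
    by (rule finite_weak_derivatives[OF assms(1) converges_along_not_diverges[OF Cons.prems]])
  moreover have "converges_along L y s" if "y \<in> ?D" for y
    using that converges_along_weak_Nil[OF Cons.prems] converges_along_vis[of L _ \<mu> s y] by blast
  ultimately show ?case using Cons.IH by (meson finite_UN_I finite_subset)
qed

section \<open>Waiting states\<close>

lemma waiting_states_tau: "L p Tau q \<Longrightarrow> waiting_states L q s \<subseteq> waiting_states L p s"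
  by (auto simp: waiting_states_def intro: weak_tau)

lemma waiting_states_vis: "L p (Vis \<mu>) q \<Longrightarrow> waiting_states L q s \<subseteq> waiting_states L p (\<mu> # s)"
  by (auto simp: waiting_states_def intro: weak_vis)

lemma waiting_states_self: "\<not> enabled L p Tau \<Longrightarrow> p \<in> waiting_states L p []"
  by (auto simp: waiting_states_def intro: weak_refl)

lemma waiting_states_Nil_nonempty:
  "\<not> diverges L p \<Longrightarrow> waiting_states L p [] \<noteq> {}"
proof (induction rule: not_diverges_induct)
  case (step p)
  then show ?case
    by (metis empty_subsetI enabled_def subset_antisym waiting_states_self waiting_states_tau
        empty_iff)
qed

section \<open>Computations of a program in parallel with a test\<close>

text \<open>The test does not move while the program performs \<tau>-steps, so it stays not good and
  the obligation to pass survives each step.\<close>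

lemma passes_weak_Nil:
  assumes "weak L p u x" "u = []" "\<not> good t" "passes co L T good p t"
  shows "passes co L T good x t"
  using assms
proof (induction rule: weak.induct)
  case (weak_tau p q s r)
  then have "comp_step co L T (p, t) (q, t)" by (auto intro: program_tau)
  from always_reaches_step[OF weak_tau.prems(3) _ this] weak_tau show ?case by simp
qed auto

lemma passes_not_diverges:
  assumes "passes co L T good p t" "\<not> good t"
  shows "\<not> diverges L p"
proof
  assume "diverges L p"
  then obtain c where c: "infinite_computation (\<lambda>x y. L x Tau y) p c" by (auto simp: diverges_def)
  then have "infinite_computation (comp_step co L T) (p, t) (\<lambda>i. (c i, t))"
    by (auto simp: infinite_computation_def intro: program_tau)
  from always_reaches_infinite_computation[OF assms(1) this] assms(2) show False by simp
qed

text \<open>The abstraction is undone in two stages. Its condition on programs lifts agreement under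
  \<open>delta\<close> to agreement under \<open>phi\<close>, giving an offer
  \<open>\<beta>'\<close> of the program; its condition on tests then moves the action of the test
  from \<open>\<beta>\<close> to \<open>\<beta>'\<close>. The actual communication is on
  \<open>\<beta>'\<close>.\<close>

lemma comm_of_abstract_comm:
  assumes "abstracts co N A L T" "\<beta> \<in> - N" "\<beta> \<in> R T t"
    and "delta A (phi A \<beta>) \<in> coR_abs co N A L p"
  shows "\<exists>y. comp_step co L T (p, t) y"
proof -
  obtain \<gamma> where \<gamma>: "\<gamma> \<in> coR co N L p" "delta A (phi A \<beta>) = delta A (phi A \<gamma>)"
    using assms(4) by (auto simp: coR_abs_def)
  then have "\<gamma> \<in> - N" by (simp add: coR_def)
  with \<gamma> assms(1,2) have "phi A \<beta> \<in> phi A ` coR co N L p"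
    unfolding abstracts_def by (metis imageI)
  then obtain \<beta>' where \<beta>': "\<beta>' \<in> coR co N L p" "phi A \<beta> = phi A \<beta>'" by blast
  then have "\<beta>' \<in> - N" by (simp add: coR_def)
  with \<beta>' assms(1-3) have "\<beta>' \<in> R T t" unfolding abstracts_def by blast
  with \<beta>' obtain p' t' where "L p (Vis (co \<beta>')) p'" "T t (Vis \<beta>') t'"
    by (auto simp: R_def coR_def enabled_def)
  then show ?thesis by (blast intro: communication)
qed

section \<open>Soundness\<close>

text \<open>\<open>X\<close> acts like the internal choice of its members: all must converge, and
  any one of them may match a waiting state of \<open>q\<close>.\<close>

definition set_abs_preorder ::
  "('a \<Rightarrow> 'a) \<Rightarrow> 'a set \<Rightarrow> ('a, 'y, 'x) label_abs \<Rightarrow> ('s, 'a) lts \<Rightarrow> 's set \<Rightarrow> 's \<Rightarrow> bool" where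
  "set_abs_preorder co N A L X q \<longleftrightarrow> (\<forall>s. (\<forall>x\<in>X. converges_along L x s) \<longrightarrow>
     converges_along L q s \<and>
     (\<forall>q'\<in>waiting_states L q s. \<exists>x\<in>X. \<exists>x'\<in>waiting_states L x s.
        coR_abs co N A L x' \<subseteq> coR_abs co N A L q'))"

lemma set_abs_preorder_singleton:
  "set_abs_preorder co N A L {p} q \<longleftrightarrow> abs_preorder co N A L p q"
  by (simp add: set_abs_preorder_def abs_preorder_def family_le_def interp_def)

lemma set_abs_preorder_tau:
  assumes "set_abs_preorder co N A L X q" "L q Tau q'"
  shows "set_abs_preorder co N A L X q'"
  using assms(1) waiting_states_tau[of L q q', OF assms(2)]
    converges_along_tau[of L q _ q', OF _ assms(2)]
  unfolding set_abs_preorder_def by blast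

text \<open>A waiting state of a member of \<open>X\<close> along \<open>\<mu> # s\<close> is a
  waiting state along \<open>s\<close> of some derivative. Derivatives end right after
  \<open>\<mu>\<close>; later \<tau>-steps are absorbed by the weak transition along
  \<open>s\<close>.\<close>

lemma set_abs_preorder_vis:
  assumes "set_abs_preorder co N A L X q" "L q (Vis \<mu>) q'" "\<And>x. x \<in> X \<Longrightarrow> \<not> diverges L x"
  shows "set_abs_preorder co N A L {y. \<exists>x\<in>X. \<exists>z. weak L x [] z \<and> L z (Vis \<mu>) y} q'"
    (is "set_abs_preorder co N A L ?Y q'")
  unfolding set_abs_preorder_def
proof (intro allI impI)
  fix s assume "\<forall>y\<in>?Y. converges_along L y s"
  then have "\<forall>x\<in>X. converges_along L x (\<mu> # s)"
    using assms(3) by (blast intro: converges_along_ConsI)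
  with assms(1) have q: "converges_along L q (\<mu> # s)"
    "\<forall>r\<in>waiting_states L q (\<mu> # s). \<exists>x\<in>X. \<exists>x'\<in>waiting_states L x (\<mu> # s).
       coR_abs co N A L x' \<subseteq> coR_abs co N A L r"
    by (auto simp: set_abs_preorder_def)
  have "\<exists>y\<in>?Y. \<exists>x'\<in>waiting_states L y s. coR_abs co N A L x' \<subseteq> coR_abs co N A L r"
    if "r \<in> waiting_states L q' s" for r
  proof -
    from that q(2) waiting_states_vis[of L q \<mu> q', OF assms(2)] obtain x x' where
      x: "x \<in> X" "x' \<in> waiting_states L x (\<mu> # s)" "coR_abs co N A L x' \<subseteq> coR_abs co N A L r"
      by (meson subsetD)
    from x(2) obtain z y where "weak L x [] z" "L z (Vis \<mu>) y" "x' \<in> waiting_states L y s"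
      by (auto simp: waiting_states_def elim!: weak_Cons_cases)
    with x show ?thesis by blast
  qed
  with converges_along_vis[of L q \<mu> s q', OF q(1) assms(2)]
  show "converges_along L q' s \<and> (\<forall>r\<in>waiting_states L q' s. \<exists>y\<in>?Y. \<exists>x'\<in>waiting_states L y s.
      coR_abs co N A L x' \<subseteq> coR_abs co N A L r)" by blast
qed

section \<open>A well-founded order on configurations\<close>

text \<open>Pairs put the successor first, as \<open>wf\<close> expects. Only steps out of passing
  configurations that are not yet good count, since others may continue forever.\<close>

definition live_step ::
  "('a \<Rightarrow> 'a) \<Rightarrow> ('p, 'a) lts \<Rightarrow> ('t, 'a) lts \<Rightarrow> ('t \<Rightarrow> bool) \<Rightarrow> (('p \<times> 't) \<times> ('p \<times> 't)) set" where
  "live_step co L T good =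
     {(y, x). passes co L T good (fst x) (snd x) \<and> \<not> good (snd x) \<and> comp_step co L T x y}"

lemma wf_live_step: "wf (live_step co L T good)"
proof (rule wfUNIVI)
  fix P x
  assume step: "\<forall>x. (\<forall>y. (y, x) \<in> live_step co L T good \<longrightarrow> P y) \<longrightarrow> P x"
  have P: "P x" if "always_reaches (comp_step co L T) (\<lambda>x. good (snd x)) x" for x
    using that
  proof induction
    case (now x)
    then have "(y, x) \<notin> live_step co L T good" for y by (simp add: live_step_def)
    with step show ?case by blast
  next
    case (later x y)
    then have "P z" if "(z, x) \<in> live_step co L T good" for z
      using that by (simp add: live_step_def)
    with step show ?case by blast
  qed
  show "P x"
  proof (cases "always_reaches (comp_step co L T) (\<lambda>x. good (snd x)) x")
    case False
    then have "(y, x) \<notin> live_step co L T good" for y by (simp add: live_step_def)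
    with step show ?thesis by blast
  qed (rule P)
qed

text \<open>Only the reflexive closure holds, as there may be no \<tau>-step at all; strict descent
  comes from the communication that follows.\<close>

lemma live_step_weak_Nil:
  assumes "weak L p u x" "u = []" "\<not> good t" "passes co L T good p t"
  shows "((x, t), (p, t)) \<in> (live_step co L T good)\<^sup>*"
  using assms
proof (induction rule: weak.induct)
  case (weak_tau p q s r)
  then have step: "comp_step co L T (p, t) (q, t)" by (auto intro: program_tau)
  with weak_tau.prems have "passes co L T good q t" by (auto dest: always_reaches_step)
  with weak_tau.IH weak_tau.prems have "((r, t), (q, t)) \<in> (live_step co L T good)\<^sup>*" by blast
  moreover have "((q, t), (p, t)) \<in> live_step co L T good"
    using step weak_tau.prems by (auto simp: live_step_def)
  ultimately show ?case by (rule rtrancl_into_rtrancl)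
qed auto

text \<open>Two nested inductions. The outer one, on the multiset of configurations, covers moves of
  the test and communications; the inner one, on the absence of divergence of \<open>q\<close>,
  covers \<tau>-steps of \<open>q\<close>, which leave \<open>X\<close> and \<open>t\<close>
  unchanged.\<close>

lemma set_abs_preorder_passes:
  assumes "finite_image L" and boomerang: "Boomerang co N L" and abs: "abstracts co N A L T"
    and "finite X" "\<And>x. x \<in> X \<Longrightarrow> passes co L T good x t" "set_abs_preorder co N A L X q"
  shows "passes co L T good q t"
proof -
  let ?r = "(live_step co L T good)\<^sup>+"
  let ?m = "\<lambda>X t. mset_set (X \<times> {t})"
  have "wf (mult ?r)" by (intro wf_mult wf_trancl wf_live_step)
  then have "\<forall>X t q. M = ?m X t \<longrightarrow> finite X \<longrightarrow> (\<forall>x\<in>X. passes co L T good x t) \<longrightarrow>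
      set_abs_preorder co N A L X q \<longrightarrow> passes co L T good q t" for M
  proof (induction M)
    case (less M)
    show ?case
    proof (intro allI impI)
      fix X t q
      assume M: "M = ?m X t" and fin: "finite X" and X: "\<forall>x\<in>X. passes co L T good x t"
        and le: "set_abs_preorder co N A L X q"
      show "passes co L T good q t"
      proof (cases "good t")
        case True
        then show ?thesis by (auto intro: now)
      next
        case False
        have conv: "\<not> diverges L x" if "x \<in> X" for x
          using that X passes_not_diverges[of co L T good x t] False by blast
        then have "\<not> diverges L q"
          using le converges_along_NilI[of L] converges_along_not_diverges[of L q "[]"]
          unfolding set_abs_preorder_def by blast
        then show ?thesis
          using le
        proof (induction rule: not_diverges_induct)
          case (step q)
          have wait: "\<forall>q'\<in>waiting_states L q []. \<exists>x\<in>X. \<exists>x'\<in>waiting_states L x [].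
              coR_abs co N A L x' \<subseteq> coR_abs co N A L q'"
            using step.prems conv converges_along_NilI[of L] unfolding set_abs_preorder_def by blast
          \<comment> \<open>The waiting state that \<open>q\<close> has needs a match in
            \<open>X\<close>. The multiset descent below requires \<open>X\<close> to be
            nonempty.\<close>
          with waiting_states_Nil_nonempty[OF step.hyps] have "X \<noteq> {}" by blast
          have smaller: "passes co L T good q' t'"
            if "finite X'" "\<forall>x\<in>X'. passes co L T good x t'" "set_abs_preorder co N A L X' q'"
              "\<forall>y\<in>X'. \<exists>x\<in>X. ((y, t'), (x, t)) \<in> ?r" for X' t' q'
          proof -
            \<comment> \<open>The whole multiset is exchanged, hence the empty common part
              \<open>{#}\<close>.\<close>
            have "({#} + ?m X' t', {#} + ?m X t) \<in> mult ?r"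
            proof (rule one_step_implies_mult)
              show "?m X t \<noteq> {#}"
                using \<open>X \<noteq> {}\<close> fin by (simp add: mset_set_empty_iff)
              show "\<forall>k\<in>set_mset (?m X' t'). \<exists>j\<in>set_mset (?m X t). (k, j) \<in> ?r"
                using that fin by auto
            qed
            then have "(?m X' t', M) \<in> mult ?r" by (simp add: M)
            from less.IH[OF this] that(1-3) show ?thesis by blast
          qed
          have "\<exists>y. comp_step co L T (q, t) y"
          proof (rule ccontr)
            assume stuck: "\<nexists>y. comp_step co L T (q, t) y"
            then have "\<not> enabled L q Tau" by (auto simp: enabled_def intro: program_tau)
            \<comment> \<open>Being stuck, \<open>q\<close> is its own waiting state. Its match
              \<open>x'\<close> can step with \<open>t\<close>, and each kind of step is shown to be
              available to \<open>q\<close> as well.\<close>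
            then obtain x x' where x: "x \<in> X" "x' \<in> waiting_states L x []"
              "coR_abs co N A L x' \<subseteq> coR_abs co N A L q"
              using wait waiting_states_self by meson
            then have "passes co L T good x' t"
              using X False passes_weak_Nil[of L x "[]" x' good t co T] by (simp add: waiting_states_def)
            then obtain y where "comp_step co L T (x', t) y"
              using False always_reaches_progress[of "comp_step co L T" "\<lambda>x. good (snd x)" "(x', t)"]
              by auto
            then show False
            proof (cases rule: comp_stepE)
              case (program_tau p')
              with x show ?thesis by (auto simp: waiting_states_def enabled_def)
            next
              case (test_tau t')
              with stuck show ?thesis by (blast intro: comp_step.test_tau)
            next
              case (communication \<mu> p' t')
              show ?thesis
              proof (cases "\<mu> \<in> N")
                case True
                then obtain q' where "L q (Vis (co \<mu>)) q'"
                  using boomerang unfolding Boomerang_def by blast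
                with communication stuck show ?thesis by (blast intro: comp_step.communication)
              next
                case False
                with communication have "delta A (phi A \<mu>) \<in> coR_abs co N A L x'" "\<mu> \<in> R T t"
                  by (auto simp: coR_abs_def coR_def R_def enabled_def)
                with x(3) False stuck show ?thesis
                  using comm_of_abstract_comm[OF abs, of \<mu> t q] by blast
              qed
            qed
          qed
          then obtain y where y: "comp_step co L T (q, t) y" ..
          from y show ?case
          proof (rule later)
            fix z assume "comp_step co L T (q, t) z"
            then show "always_reaches (comp_step co L T) (\<lambda>x. good (snd x)) z"
            proof (cases rule: comp_stepE)
              case (program_tau q')
              with step.IH set_abs_preorder_tau[of co N A L X q q', OF step.prems] show ?thesis by simp
            next
              case (test_tau t')
              then have st: "comp_step co L T (x, t) (x, t')" for x
                by (blast intro: comp_step.test_tau)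
              \<comment> \<open>The same step of the test is taken next to every program in
                \<open>X\<close>.\<close>
              have "passes co L T good q t'"
              proof (rule smaller[OF fin _ step.prems])
                show "\<forall>x\<in>X. passes co L T good x t'"
                  using X False always_reaches_step[of "comp_step co L T" "\<lambda>x. good (snd x)", OF _ _ st]
                  by simp
                show "\<forall>y\<in>X. \<exists>x\<in>X. ((y, t'), (x, t)) \<in> ?r"
                  using X False st by (intro ballI bexI r_into_trancl) (auto simp: live_step_def)
              qed
              with test_tau show ?thesis by simp
            next
              case (communication \<mu> q' t')
              let ?Y = "{y. \<exists>x\<in>X. \<exists>z. weak L x [] z \<and> L z (Vis (co \<mu>)) y}"
              have Y: "passes co L T good y t' \<and> ((y, t'), (x, t)) \<in> ?r"
                if "x \<in> X" "weak L x [] z" "L z (Vis (co \<mu>)) y" for x y z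
              proof -
                have z: "passes co L T good z t" 
                  using that X False passes_weak_Nil[of L x "[]" z good t co T] by blast
                have st: "comp_step co L T (z, t) (y, t')"
                  using that communication by (blast intro: comp_step.communication)
                have "((y, t'), (z, t)) \<in> live_step co L T good"
                  using z st False by (simp add: live_step_def)
                moreover have "((z, t), (x, t)) \<in> (live_step co L T good)\<^sup>*"
                  using that X False live_step_weak_Nil[of L x "[]" z good t co T] by blast
                moreover have "passes co L T good y t'"
                  using always_reaches_step[OF z _ st] False by simp
                ultimately show ?thesis by simp
              qed
              have "passes co L T good q' t'"
              proof (rule smaller)
                have "?Y = (\<Union>x\<in>X. {y. \<exists>z. weak L x [] z \<and> L z (Vis (co \<mu>)) y})" by auto
                then show "finite ?Y"
                  using fin conv finite_weak_derivatives[OF assms(1)] by auto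
                show "set_abs_preorder co N A L ?Y q'"
                  using set_abs_preorder_vis[of co N A L X q "co \<mu>" q', OF step.prems] communication conv by blast
              qed (use Y in blast)+
              with communication show ?thesis by simp
            qed
          qed
        qed
      qed
    qed
  qed
  with assms(4-6) show ?thesis by blast
qed

section \<open>Completeness\<close>

text \<open>Induction on the passing of \<open>(p', t')\<close>, which simulates
  \<open>(p, t)\<close>. Each step of \<open>(p, t)\<close> is matched by one that restores the
  relation, or ends in a successor of \<open>(p', t')\<close>, or ends in \<open>(p', t')\<close>
  itself.\<close>

lemma passes_move_message:
  assumes co: "involutive co" and L: "class_M co N L" and T: "class_A co N T"
    and inv: "good_invariant N T good" and "\<eta> \<in> N"
    and "passes co L T good p' t'" "T t (Vis \<eta>) t'" "L p' (Vis \<eta>) p"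
  shows "passes co L T good p t"
proof -
  have "passes co L T good p t"
    if "always_reaches (comp_step co L T) (\<lambda>x. good (snd x)) x" "x = (p', t')"
      "T t (Vis \<eta>) t'" "L p' (Vis \<eta>) p" for x p' t' p t
    using that
  proof (induction arbitrary: p' t' p t)
    case (now x)
    then have "good t" using inv \<open>\<eta> \<in> N\<close> by (auto simp: good_invariant_def)
    then show ?case by (auto intro: always_reaches.now)
  next
    case (later x y)
    note t = later.prems(2) and p = later.prems(3)
    have x: "passes co L T good p' t'"
      using always_reaches.later[OF later.hyps(1,2)] later.prems(1) by simp
    \<comment> \<open>Progress: by Boomerang \<open>p\<close> can always receive the message
      \<open>\<eta>\<close> that \<open>t\<close> offers.\<close>
    obtain p0 where "L p (Vis (co \<eta>)) p0"
      using L \<open>\<eta> \<in> N\<close> unfolding class_M_def Boomerang_def by blast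
    with t have "comp_step co L T (p, t) (p0, t')" by (blast intro: comp_step.communication)
    then show ?case
    proof (rule always_reaches.later)
      fix z assume "comp_step co L T (p, t) z"
      then show "always_reaches (comp_step co L T) (\<lambda>x. good (snd x)) z"
      proof (cases rule: comp_stepE)
        case (program_tau p1)
        then obtain p2 where "L p' Tau p2" "L p2 (Vis \<eta>) p1"
          using L \<open>\<eta> \<in> N\<close> p unfolding class_M_def N_delay_def by blast
        then show ?thesis
          using later.IH[of "(p2, t')" p2 t' t p1] later.prems(1) t program_tau
          by (simp add: comp_step.program_tau)
      next
        case (test_tau t1)
        \<comment> \<open>In the second alternative the test has consumed its own message;
          \<open>(p', t')\<close> gets to the same state by letting \<open>p'\<close> send
          \<open>\<eta>\<close> to \<open>t'\<close>.\<close>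
        then consider t2 where "T t' Tau t2" "T t1 (Vis \<eta>) t2" | "T t' (Vis (co \<eta>)) t1"
          using T \<open>\<eta> \<in> N\<close> t unfolding class_A_def N_tau_def by blast
        then show ?thesis
        proof cases
          case 1
          then show ?thesis
            using later.IH[of "(p', t2)" p' t2 t1 p] later.prems(1) p test_tau
            by (simp add: comp_step.test_tau)
        next
          case 2
          moreover have "L p' (Vis (co (co \<eta>))) p" using p co by (simp add: involutive_def)
          ultimately have "comp_step co L T (p', t') (p, t1)" by (blast intro: comp_step.communication)
          with later.hyps later.prems(1) test_tau show ?thesis by simp
        qed
      next
        case (communication \<mu> p1 t1)
        show ?thesis
        proof (cases "\<mu> = \<eta>")
          case True
          then have "t1 = t'"
            using T \<open>\<eta> \<in> N\<close> t communication unfolding class_A_def N_determinacy_def by blast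
          \<comment> \<open>Here \<open>p\<close> receives the very message that \<open>p'\<close>
            emitted, so \<open>p'\<close> reaches the result internally or already equals
            it.\<close>
          have "L p' Tau p1 \<or> p' = p1"
            using L \<open>\<eta> \<in> N\<close> p communication True unfolding class_M_def Fwd_Feedback_def by blast
          then show ?thesis
          proof
            assume "L p' Tau p1"
            then have "comp_step co L T (p', t') (p1, t')" by (rule comp_step.program_tau)
            with later.hyps later.prems(1) communication \<open>t1 = t'\<close> show ?thesis by simp
          next
            assume "p' = p1"
            with x communication \<open>t1 = t'\<close> show ?thesis by simp
          qed
        next
          case False
          then obtain t2 where t2: "T t' (Vis \<mu>) t2" "T t1 (Vis \<eta>) t2"
            using T \<open>\<eta> \<in> N\<close> t communication unfolding class_A_def N_confluence_def by blast
          obtain p2 where p2: "L p' (Vis (co \<mu>)) p2" "L p2 (Vis \<eta>) p1"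
            using L \<open>\<eta> \<in> N\<close> p communication unfolding class_M_def N_delay_def by blast
          have "comp_step co L T (p', t') (p2, t2)"
            using p2 t2 by (blast intro: comp_step.communication)
          with later.IH[of "(p2, t2)" p2 t2 t1 p1] later.prems(1) t2 p2 communication show ?thesis by simp
        qed
      qed
    qed
  qed
  with assms(6-) show ?thesis by blast
qed

section \<open>Passing the characteristic tests\<close>

text \<open>The test performs the duals of the trace of the program, hence \<open>map co s\<close>.
  The predicate \<open>Q\<close> lets one induction serve both the convergence and the acceptance
  tests.\<close>

lemma passes_test_family:
  assumes "involutive co" "class_M co N L" "class_A co N T" "good_invariant N T good"
    and f: "test_family N T good f"
    and base: "\<And>p. \<not> diverges L p \<Longrightarrow> (\<forall>p'\<in>waiting_states L p []. Q p') \<Longrightarrow>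
      passes co L T good p (f [])"
    and "converges_along L p s" "\<forall>p'\<in>waiting_states L p s. Q p'"
  shows "passes co L T good p (f (map co s))"
  using assms(7-)
proof (induction s arbitrary: p)
  case Nil
  then show ?case using base converges_along_not_diverges by force
next
  case (Cons \<mu> s)
  have co2: "co (co \<mu>) = \<mu>" using assms(1) by (simp add: involutive_def)
  have tail: "passes co L T good p' (f (map co s))"
    if "L p (Vis \<mu>) p'" "converges_along L p (\<mu> # s)" "\<forall>p'\<in>waiting_states L p (\<mu> # s). Q p'" for p p'
    using that Cons.IH[of p'] converges_along_vis[of L p \<mu> s p'] waiting_states_vis[of L p \<mu> p' s]
    by blast
  show ?case
  proof (cases "co \<mu> \<in> N")
    case True
    \<comment> \<open>Boomerang at \<open>co \<mu>\<close> makes \<open>p'\<close> a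
      \<open>\<mu>\<close>-derivative of \<open>p\<close>, so the induction hypothesis applies to
      it; moving the message back then gives the claim for \<open>p\<close>.\<close>
    then obtain p' where p': "L p (Vis \<mu>) p'" "L p' (Vis (co \<mu>)) p"
      using assms(2) co2 unfolding class_M_def Boomerang_def by metis
    have "T (f (co \<mu> # map co s)) (Vis (co \<mu>)) (f (map co s))"
      using f unfolding test_family_def by blast
    with passes_move_message[OF assms(1-4) True tail] p' Cons.prems show ?thesis by simp
  next
    case False
    let ?t = "f (co \<mu> # map co s)"
    from Cons.prems(1) have "\<not> diverges L p" by (rule converges_along_not_diverges)
    \<comment> \<open>With a blocking head, any \<tau>-step or deviating action of the test is good.
      Only the expected communication and \<tau>-steps of \<open>p\<close> remain, and the latter
      terminate.\<close>
    then show ?thesis using Cons.prems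
    proof (induction rule: not_diverges_induct)
      case (step p)
      obtain t' where "T ?t Tau t'"
        using f False unfolding test_family_def enabled_def by blast
      then have "comp_step co L T (p, ?t) (p, t')" by (rule test_tau)
      then have "passes co L T good p ?t"
      proof (rule later)
        fix z assume "comp_step co L T (p, ?t) z"
        then show "always_reaches (comp_step co L T) (\<lambda>x. good (snd x)) z"
        proof (cases rule: comp_stepE)
          case (program_tau p')
          with step.prems have "converges_along L p' (\<mu> # s)"
            "\<forall>p'\<in>waiting_states L p' (\<mu> # s). Q p'"
            using converges_along_tau[of L p _ p'] waiting_states_tau[of L p p'] by blast+
          with step.IH program_tau show ?thesis by simp
        next
          case (test_tau t')
          then have "good t'" using f False unfolding test_family_def by blast
          with test_tau show ?thesis by (auto intro: now)
        next
          case (communication \<nu> p' t')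
          show ?thesis
          proof (cases "\<nu> = co \<mu>")
            case True
            then have "t' = f (map co s)"
              using f False communication unfolding test_family_def by blast
            with tail communication True co2 step.prems show ?thesis by simp
          next
            case neq: False
            then have "good t'" using f False communication unfolding test_family_def by blast
            with communication show ?thesis by (auto intro: now)
          qed
        qed
      qed
      then show ?case by simp
    qed
  qed
qed

text \<open>The test can always finish by its own \<tau>-step, so only a divergence of the program
  could prevent success.\<close>

lemma passes_cnv_base:
  assumes "cnv_base T good t" "\<not> diverges L p"
  shows "passes co L T good p t"
  using assms(2)
proof (induction rule: not_diverges_induct)
  case (step p)
  obtain t' where "T t Tau t'" using assms(1) by (auto simp: cnv_base_def enabled_def)
  then have "comp_step co L T (p, t) (p, t')" by (rule test_tau)
  then show ?case
  proof (rule later)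
    fix z assume "comp_step co L T (p, t) z"
    then show "always_reaches (comp_step co L T) (\<lambda>x. good (snd x)) z"
      by (cases rule: comp_stepE)
        (use step.IH assms(1) in \<open>auto simp: cnv_base_def enabled_def intro: always_reaches.now\<close>)
  qed
qed

text \<open>A program without \<tau>-steps is its own waiting state, so it shares an abstract label
  with \<open>E\<close>, which yields a real communication. Every communication uses a blocking
  action and makes the test good.\<close>

lemma passes_acc_base:
  assumes abs: "abstracts co N A L T" and acc: "acc_base N A T good E t"
    and "\<not> diverges L p" "\<forall>p'\<in>waiting_states L p []. coR_abs co N A L p' \<inter> E \<noteq> {}"
  shows "passes co L T good p t"
  using assms(3-)
proof (induction rule: not_diverges_induct)
  case (step p)
  have "\<exists>y. comp_step co L T (p, t) y"
  proof (cases "enabled L p Tau")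
    case True
    then show ?thesis by (auto simp: enabled_def intro: program_tau)
  next
    case False
    with step.prems waiting_states_self[of L p] obtain e where e: "e \<in> coR_abs co N A L p" "e \<in> E" by blast
    with acc obtain \<beta> where "\<beta> \<in> - N" "e = delta A (phi A \<beta>)" "enabled T t (Vis \<beta>)"
      unfolding acc_base_def by blast
    with e show ?thesis using comm_of_abstract_comm[OF abs, of \<beta> t p] by (simp add: R_def)
  qed
  then obtain y where "comp_step co L T (p, t) y" ..
  then show ?case
  proof (rule later)
    fix z assume "comp_step co L T (p, t) z"
    then show "always_reaches (comp_step co L T) (\<lambda>x. good (snd x)) z"
    proof (cases rule: comp_stepE)
      case (program_tau p')
      with step.prems have "\<forall>r\<in>waiting_states L p' []. coR_abs co N A L r \<inter> E \<noteq> {}"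
        using waiting_states_tau[of L p p' "[]"] by blast
      with step.IH program_tau show ?thesis by blast
    next
      case (test_tau t')
      with acc show ?thesis by (auto simp: acc_base_def enabled_def)
    next
      case (communication \<mu> p' t')
      with acc have "good t'" unfolding acc_base_def enabled_def by (metis Compl_iff)
      with communication show ?thesis by (auto intro: now)
    qed
  qed
qed

section \<open>What a passed characteristic test reveals\<close>

text \<open>No test of the family is good, so passing persists along the computation in which the
  program performs \<open>s1\<close> and the test consumes that prefix.\<close>

lemma passes_test_family_weak:
  assumes "involutive co" and f: "test_family N T good f"
    and "weak L q s1 q'" "passes co L T good q (f (map co (s1 @ s2)))"
  shows "passes co L T good q' (f (map co s2))"
  using assms(3-)
proof (induction rule: weak.induct)
  case (weak_tau p q s r)
  moreover have "\<not> good (f (map co (s @ s2)))" using f unfolding test_family_def by blast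
  ultimately show ?case
    using always_reaches_step[OF weak_tau.prems _ program_tau] by simp
next
  case (weak_vis p \<mu> q s r)
  have not_good: "\<not> good (f (map co ((\<mu> # s) @ s2)))" using f unfolding test_family_def by blast
  have "T (f (map co ((\<mu> # s) @ s2))) (Vis (co \<mu>)) (f (map co (s @ s2)))"
    using f unfolding test_family_def by simp
  moreover have "L p (Vis (co (co \<mu>))) q" using weak_vis.hyps(1) assms(1) by (simp add: involutive_def)
  ultimately have "comp_step co L T (p, f (map co ((\<mu> # s) @ s2))) (q, f (map co (s @ s2)))"
    by (blast intro: communication)
  from always_reaches_step[OF weak_vis.prems _ this] not_good weak_vis.IH show ?case by simp
qed simp

lemma converges_along_of_passes:
  assumes "involutive co" and f: "test_family N T good f"
    and "passes co L T good q (f (map co s))"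
  shows "converges_along L q s"
  unfolding converges_along_def
proof (intro allI impI, elim conjE)
  fix s1 q' assume "prefix s1 s" and q': "weak L q s1 q'"
  then obtain s2 where "s = s1 @ s2" by (auto elim: prefixE)
  with assms(3) have "passes co L T good q' (f (map co s2))"
    using passes_test_family_weak[OF assms(1) f q'] by blast
  moreover have "\<not> good (f (map co s2))" using f unfolding test_family_def by blast
  ultimately show "\<not> diverges L q'" by (rule passes_not_diverges)
qed

text \<open>After \<open>s\<close>, neither \<open>q'\<close> nor the remaining test has a
  \<tau>-step. Passing forces a step, which must be a communication, on a blocking action whose
  abstract label lies in \<open>E\<close>.\<close>

lemma coR_abs_meets_of_passes:
  assumes "involutive co" and f: "test_family N T good f" and acc: "acc_base N A T good E (f [])"
    and "passes co L T good q (f (map co s))" "q' \<in> waiting_states L q s"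
  shows "coR_abs co N A L q' \<inter> E \<noteq> {}"
proof -
  have q': "weak L q s q'" "\<not> enabled L q' Tau" using assms(5) by (auto simp: waiting_states_def)
  have "passes co L T good q' (f [])"
    using passes_test_family_weak[OF assms(1) f q'(1), where ?s2.0 = "[]"] assms(4) by simp
  moreover have "\<not> good (f [])" using f unfolding test_family_def by blast
  ultimately obtain y where "comp_step co L T (q', f []) y"
    using always_reaches_progress[of "comp_step co L T" "\<lambda>x. good (snd x)" "(q', f [])"] by auto
  then show ?thesis
  proof (cases rule: comp_stepE)
    case (communication \<mu> q'' t')
    then have "\<mu> \<notin> N" "delta A (phi A \<mu>) \<in> E" "\<mu> \<in> coR co N L q'"
      using acc by (auto simp: acc_base_def enabled_def coR_def)
    then show ?thesis by (auto simp: coR_abs_def)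
  qed (use q' acc in \<open>auto simp: enabled_def acc_base_def\<close>)
qed

lemma abs_preorder_of_must_preorder:
  assumes "involutive co" and fin: "finite_image L" and "class_M co N L" "class_A co N T"
    and "good_invariant N T good"
    and A: "label_abstraction N A" and abs: "abstracts co N A L T"
    and ax: "AxCmpl N T good A" and fy: "finitary co N A L"
    and le: "must_preorder co L T good p q"
  shows "abs_preorder co N A L p q"
  unfolding abs_preorder_def
proof (intro allI impI conjI)
  fix s assume conv: "converges_along L p s"
  from ax obtain tc ta where
    tc: "test_family N T good tc" "cnv_base T good (tc [])" and
    ta: "\<And>E. finite E \<Longrightarrow> E \<subseteq> absX A \<Longrightarrow> test_family N T good (\<lambda>s. ta s E)"
      "\<And>E. finite E \<Longrightarrow> E \<subseteq> absX A \<Longrightarrow> acc_base N A T good E (ta [] E)"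
    unfolding AxCmpl_def by blast
  note passes = passes_test_family[OF assms(1,3,4,5)]
  have transfer: "passes co L T good q t" if "passes co L T good p t" for t
    using le that unfolding must_preorder_def must_iff_passes by blast
  have "passes co L T good p (tc (map co s))"
    using passes[OF tc(1) passes_cnv_base[OF tc(2)] conv, where Q = "\<lambda>_. True"] by simp
  from converges_along_of_passes[OF assms(1) tc(1) transfer[OF this]]
  show "converges_along L q s" .
  show "family_le (interp co N A L p s) (interp co N A L q s)"
  proof (rule ccontr)
    assume "\<not> family_le (interp co N A L p s) (interp co N A L q s)"
    then obtain q' where q': "q' \<in> waiting_states L q s"
      and none: "\<forall>p'\<in>waiting_states L p s. \<not> coR_abs co N A L p' \<subseteq> coR_abs co N A L q'"
      by (auto simp: family_le_def interp_def)
    \<comment> \<open>Everything that some waiting state of \<open>p\<close> offers beyond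
      \<open>q'\<close>. Each of them meets \<open>E\<close> because its inclusion in the offers of
      \<open>q'\<close> fails, whereas \<open>q'\<close> offers nothing in \<open>E\<close>.\<close>
    define E where "E = (\<Union>p'\<in>waiting_states L p s. coR_abs co N A L p' - coR_abs co N A L q')"
    have "finite (waiting_states L p s)"
      by (rule finite_subset[OF _ finite_weak[OF fin conv]]) (auto simp: waiting_states_def)
    then have "finite E" using fy by (auto simp: E_def finitary_def)
    moreover have "E \<subseteq> absX A"
      using A by (auto simp: E_def coR_abs_def coR_def label_abstraction_def Pi_def)
    ultimately have E: "test_family N T good (\<lambda>s. ta s E)" "acc_base N A T good E (ta [] E)"
      using ta by auto
    have "\<forall>p'\<in>waiting_states L p s. coR_abs co N A L p' \<inter> E \<noteq> {}"
      using none unfolding E_def by blast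
    then have "passes co L T good p (ta (map co s) E)"
      using passes[OF E(1) passes_acc_base[OF abs E(2)] conv] by blast
    from coR_abs_meets_of_passes[OF assms(1) E(1) E(2) transfer[OF this] q']
    show False by (auto simp: E_def)
  qed
qed

theorem theorem7:
  fixes co :: "'a::countable \<Rightarrow> 'a"
    and N :: "'a set"
    and L :: "('p, 'a) lts"
    and T :: "('t, 'a) lts"
    and good :: "'t \<Rightarrow> bool"
    and A :: "('a, 'y, 'x) label_abs"
    and p q :: 'p
  assumes "involutive co"
    and "finite_image L" and "class_M co N L"
    and "finite_image T" and "class_A co N T"
    and "good_invariant N T good"
    and "label_abstraction N A" and "abstracts co N A L T"
  shows "(abs_preorder co N A L p q \<longrightarrow> must_preorder co L T good p q) \<and>
         (AxCmpl N T good A \<and> finitary co N A L \<longrightarrow>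
            must_preorder co L T good p q \<longrightarrow> abs_preorder co N A L p q)"
proof (intro conjI impI)
  assume le: "abs_preorder co N A L p q"
  have "Boomerang co N L" using assms(3) by (simp add: class_M_def)
  with le show "must_preorder co L T good p q"
    using set_abs_preorder_passes[OF assms(2) _ assms(8), of "{p}"]
    by (auto simp: must_preorder_def must_iff_passes set_abs_preorder_singleton)
next
  assume "AxCmpl N T good A \<and> finitary co N A L" "must_preorder co L T good p q"
  with assms show "abs_preorder co N A L p q"
    by (blast intro: abs_preorder_of_must_preorder)
qed

end
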